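(* Let $(\mathcal M,\delta)\models T_g^\delta$, where $T$ admits $\mathcal C^\infty$-cell decomposition. Let $C\subseteq M^k$ be a $\delta$-cell of order $n\in\mathbb N^k$, and let $a\in M^k$. For $r\in\mathbb N$, let $n+r$ be obtained by adding $r$ to each coordinate of $n$. Then $a\in\operatorname{cl}_{n+r}(C)$ if and only if $\operatorname{Jet}_{n+r}(a)\in\operatorname{cl}(\operatorname{Jet}_{n+r}(C))$ in $E_{n+r}$. Consequently, $a\in\operatorname{cl}_\delta(C)$ if and only if $a\in\operatorname{cl}_{n+r}(C)$ for all $r\in\mathbb N$. Equivalently, $a\in\operatorname{cl}_\delta(C)$ if and only if $\operatorname{Jet}_{n+r}(a)\in\operatorname{cl}(\operatorname{Jet}_{n+r}(C))$ for all $r\in\mathbb N$.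
   Context: $T$ is a complete o-minimal theory expanding the theory of real closed ordered fields in a language $\mathcal L$, with quantifier elimination and universally axiomatizable. $\mathcal L^\delta=\mathcal L\cup\{\delta\}$. A $T$-derivation on $\mathcal M\models T$ is a map $\delta:M\to M$ with $\delta f(u)=\mathbf J_f(u)\,\delta u$ for every $\mathcal L(\varnothing)$-definable $\mathcal C^1$-function $f:U\to M$, $U\subseteq M^n$ open, $u\in U$. $T_g^\delta$ is the theory of $(\mathcal M,\delta)$ with $\mathcal M\models T$ and $\delta$ a $T$-derivation that is generic: for every $\mathcal L(M)$-definable $A\subseteq M^{n+1}$ whose projection to the first $n$ coordinates has dimension $n$, there is $a\in M$ with $(a,\delta a,\ldots,\delta^na)\in A$. For $n\in\mathbb N^k$, $E_n=\prod_{i=1}^kM^{n_i+1}$ with the Euclidean topology (sup metric) and $\operatorname{Jet}_n(a)=(a_i,\delta a_i,\ldots,\delta^{n_i}a_i)_{1\le i\le k}$ for $a\in M^k$. $\mathcal T_n$ is the topology on $M^k$ induced by the $M$-valued metric $d_n(a,b)=\max_{i}\max_{0\le j\le n_i}|\delta^ja_i-\delta^jb_i|$. The $\delta$-topology is $\mathcal T_\delta=\bigcup_{n\in\mathbb N^k}\mathcal T_n$. $\operatorname{cl}_n$, $\operatorname{cl}_\delta$ and $\operatorname{cl}$ denote closure in $\mathcal T_n$, in $\mathcal T_\delta$, and Euclidean closure, respectively. For a quantifier-free $\mathcal L^\delta(M)$-formula $\varphi(x_1,\ldots,x_k)$ (with $\delta$ applied to variables as $\delta^jx_i$), $\operatorname{ord}(\varphi)=(n_1,\ldots,n_k)$,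 $n_i$ the largest order of a derivative of $x_i$ occurring (0 if none). If $\varphi$ defines $C$, $C_\varphi^{\mathcal L}\subseteq E_n$ is defined by replacing each $\delta^jx_i$ by the coordinate $x_i^{(j)}$ of $E_n$. $\varphi$ is a source formula for $C$ if it defines $C$, $C_\varphi^{\mathcal L}$ is an o-minimal cell and $\operatorname{Jet}_n(C)$ is dense in it. A $\delta$-cell is a set admitting a source formula; its order is the minimal order of a source formula with respect to reverse lexicographic order ($m\prec n$ if $m_i<n_i$ at the largest $i$ with $m_i\neq n_i$). *)

theory Defs
  imports "HOL-Analysis.Abstract_Topology" "HOL-Algebra.Ring"
begin

section \<open>First-order languages expanding that of ordered rings\<close>

datatype 'f fsym = FZero | FOne | FPlus | FTimes | FExt 'f
datatype 'r rsym = RLess | RExt 'r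

text \<open>A language consists of the symbols of ordered rings together with the additional symbols
  and arities recorded here. Both sets of additional symbols may be empty.\<close>

record ('f, 'r) language =
  fun_syms :: "'f set"
  rel_syms :: "'r set"
  fun_ar :: "'f \<Rightarrow> nat"
  rel_ar :: "'r \<Rightarrow> nat"

fun is_fsym :: "('f, 'r) language \<Rightarrow> 'f fsym \<Rightarrow> nat \<Rightarrow> bool" where
  "is_fsym L FZero n \<longleftrightarrow> n = 0"
| "is_fsym L FOne n \<longleftrightarrow> n = 0"
| "is_fsym L FPlus n \<longleftrightarrow> n = 2"
| "is_fsym L FTimes n \<longleftrightarrow> n = 2"
| "is_fsym L (FExt f) n \<longleftrightarrow> f \<in> fun_syms L \<and> n = fun_ar L f"

fun is_rsym :: "('f, 'r) language \<Rightarrow> 'r rsym \<Rightarrow> nat \<Rightarrow> bool" where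
  "is_rsym L RLess n \<longleftrightarrow> n = 2"
| "is_rsym L (RExt p) n \<longleftrightarrow> p \<in> rel_syms L \<and> n = rel_ar L p"

datatype ('f, 'v) tm = Var 'v | Fn "'f fsym" "('f, 'v) tm list"

datatype ('f, 'r, 'v) fm =
    Equal "('f, 'v) tm" "('f, 'v) tm"
  | Rel "'r rsym" "('f, 'v) tm list"
  | Neg "('f, 'r, 'v) fm"
  | Conj "('f, 'r, 'v) fm" "('f, 'r, 'v) fm"
  | Exists 'v "('f, 'r, 'v) fm"
  | Forall 'v "('f, 'r, 'v) fm"

fun is_tm :: "('f, 'r) language \<Rightarrow> ('f, 'v) tm \<Rightarrow> bool" where
  "is_tm L (Var v) \<longleftrightarrow> True"
| "is_tm L (Fn g ts) \<longleftrightarrow> is_fsym L g (length ts) \<and> (\<forall>t\<in>set ts. is_tm L t)"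

fun is_fm :: "('f, 'r) language \<Rightarrow> ('f, 'r, 'v) fm \<Rightarrow> bool" where
  "is_fm L (Equal s t) \<longleftrightarrow> is_tm L s \<and> is_tm L t"
| "is_fm L (Rel p ts) \<longleftrightarrow> is_rsym L p (length ts) \<and> (\<forall>t\<in>set ts. is_tm L t)"
| "is_fm L (Neg \<phi>) \<longleftrightarrow> is_fm L \<phi>"
| "is_fm L (Conj \<phi> \<psi>) \<longleftrightarrow> is_fm L \<phi> \<and> is_fm L \<psi>"
| "is_fm L (Exists v \<phi>) \<longleftrightarrow> is_fm L \<phi>"
| "is_fm L (Forall v \<phi>) \<longleftrightarrow> is_fm L \<phi>"

fun tvars :: "('f, 'v) tm \<Rightarrow> 'v set" where
  "tvars (Var v) = {v}"
| "tvars (Fn g ts) = (\<Union>t\<in>set ts. tvars t)"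

fun fv :: "('f, 'r, 'v) fm \<Rightarrow> 'v set" where
  "fv (Equal s t) = tvars s \<union> tvars t"
| "fv (Rel p ts) = (\<Union>t\<in>set ts. tvars t)"
| "fv (Neg \<phi>) = fv \<phi>"
| "fv (Conj \<phi> \<psi>) = fv \<phi> \<union> fv \<psi>"
| "fv (Exists v \<phi>) = fv \<phi> - {v}"
| "fv (Forall v \<phi>) = fv \<phi> - {v}"

fun qfree :: "('f, 'r, 'v) fm \<Rightarrow> bool" where
  "qfree (Equal s t) \<longleftrightarrow> True"
| "qfree (Rel p ts) \<longleftrightarrow> True"
| "qfree (Neg \<phi>) \<longleftrightarrow> qfree \<phi>"
| "qfree (Conj \<phi> \<psi>) \<longleftrightarrow> qfree \<phi> \<and> qfree \<psi>"
| "qfree (Exists v \<phi>) \<longleftrightarrow> False"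
| "qfree (Forall v \<phi>) \<longleftrightarrow> False"

inductive universal :: "('f, 'r, 'v) fm \<Rightarrow> bool" where
  "qfree \<phi> \<Longrightarrow> universal \<phi>"
| "universal \<phi> \<Longrightarrow> universal (Forall v \<phi>)"

definition is_sentence :: "('f, 'r) language \<Rightarrow> ('f, 'r, nat) fm \<Rightarrow> bool" where
  "is_sentence L \<sigma> \<longleftrightarrow> is_fm L \<sigma> \<and> fv \<sigma> = {}"


section \<open>Structures and theories\<close>

record ('f, 'r, 'u) struct =
  Univ :: "'u set"
  fint :: "'f fsym \<Rightarrow> 'u list \<Rightarrow> 'u"
  rint :: "'r rsym \<Rightarrow> 'u list \<Rightarrow> bool"

definition is_struct :: "('f, 'r) language \<Rightarrow> ('f, 'r, 'u) struct \<Rightarrow> bool" where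
  "is_struct L S \<longleftrightarrow> Univ S \<noteq> {} \<and>
     (\<forall>g xs. is_fsym L g (length xs) \<and> set xs \<subseteq> Univ S \<longrightarrow> fint S g xs \<in> Univ S)"

fun eval_tm :: "('f, 'r, 'u) struct \<Rightarrow> ('v \<Rightarrow> 'u) \<Rightarrow> ('f, 'v) tm \<Rightarrow> 'u" where
  "eval_tm S e (Var v) = e v"
| "eval_tm S e (Fn g ts) = fint S g (map (eval_tm S e) ts)"

fun sat :: "('f, 'r, 'u) struct \<Rightarrow> ('v \<Rightarrow> 'u) \<Rightarrow> ('f, 'r, 'v) fm \<Rightarrow> bool" where
  "sat S e (Equal s t) \<longleftrightarrow> eval_tm S e s = eval_tm S e t"
| "sat S e (Rel p ts) \<longleftrightarrow> rint S p (map (eval_tm S e) ts)"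
| "sat S e (Neg \<phi>) \<longleftrightarrow> \<not> sat S e \<phi>"
| "sat S e (Conj \<phi> \<psi>) \<longleftrightarrow> sat S e \<phi> \<and> sat S e \<psi>"
| "sat S e (Exists v \<phi>) \<longleftrightarrow> (\<exists>x\<in>Univ S. sat S (e(v := x)) \<phi>)"
| "sat S e (Forall v \<phi>) \<longleftrightarrow> (\<forall>x\<in>Univ S. sat S (e(v := x)) \<phi>)"

definition holds :: "('f, 'r, 'u) struct \<Rightarrow> ('f, 'r, nat) fm \<Rightarrow> bool" where
  "holds S \<sigma> \<longleftrightarrow> (\<forall>e. range e \<subseteq> Univ S \<longrightarrow> sat S e \<sigma>)"

definition models :: "('f, 'r) language \<Rightarrow> ('f, 'r, nat) fm set \<Rightarrow> ('f, 'r, 'u) struct set" where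
  "models L T = {S. is_struct L S \<and> (\<forall>\<sigma>\<in>T. holds S \<sigma>)}"

text \<open>HOL cannot quantify over all models of a theory at once, so the theory-level notions below
  speak of the models whose universe is a subset of a given type \<open>'u\<close>. The type \<open>('f, 'r, 'a) univ\<close>
  is at least as large as the set of formulas, so by the downward Loewenheim-Skolem theorem
  consequence over the models inside it is ordinary consequence. Since \<open>'a\<close> is arbitrary, every
  structure has an isomorphic copy inside such a type.\<close>

type_synonym ('f, 'r, 'a) univ = "'a + ('f, 'r, nat) fm"

definition is_theory :: "('f, 'r) language \<Rightarrow> ('f, 'r, nat) fm set \<Rightarrow> bool" where
  "is_theory L T \<longleftrightarrow> (\<forall>\<sigma>\<in>T. is_sentence L \<sigma>)"

definition complete_theory ::
    "'u itself \<Rightarrow> ('f, 'r) language \<Rightarrow> ('f, 'r, nat) fm set \<Rightarrow> bool" where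
  "complete_theory _ L T \<longleftrightarrow>
     (models L T :: ('f, 'r, 'u) struct set) \<noteq> {} \<and>
     (\<forall>\<sigma>. is_sentence L \<sigma> \<longrightarrow>
        (\<forall>S\<in>(models L T :: ('f, 'r, 'u) struct set). holds S \<sigma>) \<or>
        (\<forall>S\<in>(models L T :: ('f, 'r, 'u) struct set). holds S (Neg \<sigma>)))"

definition has_QE :: "'u itself \<Rightarrow> ('f, 'r) language \<Rightarrow> ('f, 'r, nat) fm set \<Rightarrow> bool" where
  "has_QE _ L T \<longleftrightarrow>
     (\<forall>\<phi> :: ('f, 'r, nat) fm. is_fm L \<phi> \<longrightarrow>
        (\<exists>\<psi>. is_fm L \<psi> \<and> qfree \<psi> \<and> fv \<psi> \<subseteq> fv \<phi> \<and>
           (\<forall>S\<in>(models L T :: ('f, 'r, 'u) struct set). \<forall>e. range e \<subseteq> Univ S \<longrightarrow>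
              (sat S e \<phi> \<longleftrightarrow> sat S e \<psi>))))"

definition universally_axiomatizable ::
    "'u itself \<Rightarrow> ('f, 'r) language \<Rightarrow> ('f, 'r, nat) fm set \<Rightarrow> bool" where
  "universally_axiomatizable _ L T \<longleftrightarrow>
     (\<exists>\<Sigma>. (\<forall>\<sigma>\<in>\<Sigma>. is_sentence L \<sigma> \<and> universal \<sigma>) \<and>
        (models L \<Sigma> :: ('f, 'r, 'u) struct set) = models L T)"


section \<open>Real closed ordered fields\<close>

definition fld :: "('f, 'r, 'u) struct \<Rightarrow> 'u ring" where
  "fld S = \<lparr>carrier = Univ S, monoid.mult = (\<lambda>x y. fint S FTimes [x, y]), one = fint S FOne [],
     zero = fint S FZero [], add = (\<lambda>x y. fint S FPlus [x, y])\<rparr>"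

definition lt :: "('f, 'r, 'u) struct \<Rightarrow> 'u \<Rightarrow> 'u \<Rightarrow> bool" where
  "lt S x y \<longleftrightarrow> rint S RLess [x, y]"

definition is_ordered_field :: "('f, 'r, 'u) struct \<Rightarrow> bool" where
  "is_ordered_field S \<longleftrightarrow> field (fld S) \<and>
     (\<forall>x\<in>Univ S. \<not> lt S x x) \<and>
     (\<forall>x\<in>Univ S. \<forall>y\<in>Univ S. \<forall>z\<in>Univ S. lt S x y \<longrightarrow> lt S y z \<longrightarrow> lt S x z) \<and>
     (\<forall>x\<in>Univ S. \<forall>y\<in>Univ S. lt S x y \<or> x = y \<or> lt S y x) \<and>
     (\<forall>x\<in>Univ S. \<forall>y\<in>Univ S. \<forall>z\<in>Univ S. lt S x y \<longrightarrow>
        lt S (x \<oplus>\<^bsub>fld S\<^esub> z) (y \<oplus>\<^bsub>fld S\<^esub> z)) \<and>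
     (\<forall>x\<in>Univ S. \<forall>y\<in>Univ S. lt S \<zero>\<^bsub>fld S\<^esub> x \<longrightarrow> lt S \<zero>\<^bsub>fld S\<^esub> y \<longrightarrow>
        lt S \<zero>\<^bsub>fld S\<^esub> (x \<otimes>\<^bsub>fld S\<^esub> y))"

definition is_real_closed_field :: "('f, 'r, 'u) struct \<Rightarrow> bool" where
  "is_real_closed_field S \<longleftrightarrow> is_ordered_field S \<and>
     (\<forall>x\<in>Univ S. lt S \<zero>\<^bsub>fld S\<^esub> x \<longrightarrow> (\<exists>y\<in>Univ S. y \<otimes>\<^bsub>fld S\<^esub> y = x)) \<and>
     (\<forall>(d::nat) c. odd d \<longrightarrow> c ` {..d} \<subseteq> Univ S \<longrightarrow> c d \<noteq> \<zero>\<^bsub>fld S\<^esub> \<longrightarrow>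
        (\<exists>x\<in>Univ S. (\<Oplus>\<^bsub>fld S\<^esub>i\<in>{..d}. c i \<otimes>\<^bsub>fld S\<^esub> x [^]\<^bsub>fld S\<^esub> i) = \<zero>\<^bsub>fld S\<^esub>))"

definition expands_RCF :: "'u itself \<Rightarrow> ('f, 'r) language \<Rightarrow> ('f, 'r, nat) fm set \<Rightarrow> bool" where
  "expands_RCF _ L T \<longleftrightarrow>
     (\<forall>S\<in>(models L T :: ('f, 'r, 'u) struct set). is_real_closed_field S)"

definition sabs :: "('f, 'r, 'u) struct \<Rightarrow> 'u \<Rightarrow> 'u" where
  "sabs S x = (if lt S x \<zero>\<^bsub>fld S\<^esub> then \<ominus>\<^bsub>fld S\<^esub> x else x)"

definition sdist :: "('f, 'r, 'u) struct \<Rightarrow> 'u \<Rightarrow> 'u \<Rightarrow> 'u" where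
  "sdist S x y = sabs S (x \<ominus>\<^bsub>fld S\<^esub> y)"

text \<open>Maximum of a list of nonnegative elements; the value on the empty list is zero.\<close>

definition smax :: "('f, 'r, 'u) struct \<Rightarrow> 'u list \<Rightarrow> 'u" where
  "smax S xs = foldr (\<lambda>x y. if lt S x y then y else x) xs \<zero>\<^bsub>fld S\<^esub>"


section \<open>Topologies given by metrics with values in a structure\<close>

definition mtop :: "('f, 'r, 'u) struct \<Rightarrow> 'x set \<Rightarrow> ('x \<Rightarrow> 'x \<Rightarrow> 'u) \<Rightarrow> 'x topology" where
  "mtop S X d = topology (\<lambda>U. U \<subseteq> X \<and>
     (\<forall>x\<in>U. \<exists>\<epsilon>\<in>Univ S. lt S \<zero>\<^bsub>fld S\<^esub> \<epsilon> \<and> (\<forall>y\<in>X. lt S (d x y) \<epsilon> \<longrightarrow> y \<in> U)))"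

lemma istopology_mtop:
  assumes S: "is_ordered_field S" and d: "\<And>x y. x \<in> X \<Longrightarrow> y \<in> X \<Longrightarrow> d x y \<in> Univ S"
  shows "istopology (\<lambda>U. U \<subseteq> X \<and>
     (\<forall>x\<in>U. \<exists>\<epsilon>\<in>Univ S. lt S \<zero>\<^bsub>fld S\<^esub> \<epsilon> \<and> (\<forall>y\<in>X. lt S (d x y) \<epsilon> \<longrightarrow> y \<in> U)))"
proof -
  let ?P = "\<lambda>U x. \<exists>\<epsilon>\<in>Univ S. lt S \<zero>\<^bsub>fld S\<^esub> \<epsilon> \<and> (\<forall>y\<in>X. lt S (d x y) \<epsilon> \<longrightarrow> y \<in> U)"
  have inter: "?P (U \<inter> V) x" if xX: "x \<in> X" and U: "?P U x" and V: "?P V x" for U V x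
  proof -
    obtain e1 where e1: "e1 \<in> Univ S" "lt S \<zero>\<^bsub>fld S\<^esub> e1" "\<forall>y\<in>X. lt S (d x y) e1 \<longrightarrow> y \<in> U"
      using U by blast
    obtain e2 where e2: "e2 \<in> Univ S" "lt S \<zero>\<^bsub>fld S\<^esub> e2" "\<forall>y\<in>X. lt S (d x y) e2 \<longrightarrow> y \<in> V"
      using V by blast
    have tr: "\<forall>p\<in>Univ S. \<forall>q\<in>Univ S. \<forall>r\<in>Univ S. lt S p q \<longrightarrow> lt S q r \<longrightarrow> lt S p r"
      and tot: "\<forall>p\<in>Univ S. \<forall>q\<in>Univ S. lt S p q \<or> p = q \<or> lt S q p"
      by (insert S, unfold is_ordered_field_def, (elim conjE, assumption)+)
    obtain e where e: "e = e1 \<or> e = e2" "e = e1 \<or> lt S e e1" "e = e2 \<or> lt S e e2"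
      using bspec[OF bspec[OF tot e1(1)] e2(1)] by auto
    have eU: "e \<in> Univ S" and e0: "lt S \<zero>\<^bsub>fld S\<^esub> e"
      using e(1) e1(1,2) e2(1,2) by auto
    have "y \<in> U \<inter> V" if y: "y \<in> X" "lt S (d x y) e" for y
    proof -
      note dU = d[OF xX y(1)]
      have "lt S (d x y) e1"
        using e(2) y(2) bspec[OF bspec[OF bspec[OF tr dU] eU] e1(1)] by metis
      moreover have "lt S (d x y) e2"
        using e(3) y(2) bspec[OF bspec[OF bspec[OF tr dU] eU] e2(1)] by metis
      ultimately show ?thesis using e1(3) e2(3) y(1) by simp
    qed
    then show ?thesis using eU e0 by auto
  qed
  have union: "?P (\<Union>K) x" if "U \<in> K" "?P U x" for U K x
    using that by blast
  show ?thesis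
    unfolding istopology_def
  proof (intro conjI allI impI ballI)
    fix U V x
    assume UV: "U \<subseteq> X \<and> (\<forall>x\<in>U. ?P U x)" "V \<subseteq> X \<and> (\<forall>x\<in>V. ?P V x)"
    show "U \<inter> V \<subseteq> X" using UV by blast
    assume x: "x \<in> U \<inter> V"
    show "?P (U \<inter> V) x"
    proof (rule inter)
      show "x \<in> X" using UV(1) x by blast
      show "?P U x" using UV(1) x by simp
      show "?P V x" using UV(2) x by simp
    qed
  next
    fix K x
    assume K: "\<forall>U\<in>K. U \<subseteq> X \<and> (\<forall>x\<in>U. ?P U x)"
    show "\<Union>K \<subseteq> X" using K by blast
    assume "x \<in> \<Union>K"
    then obtain U where U: "U \<in> K" "x \<in> U" by blast
    then have "?P U x" using K by simp
    then show "?P (\<Union>K) x" by (rule union[OF U(1)])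
  qed
qed

definition pw :: "('f, 'r, 'u) struct \<Rightarrow> nat \<Rightarrow> 'u list set" where
  "pw S m = {xs. length xs = m \<and> set xs \<subseteq> Univ S}"

definition line :: "('f, 'r, 'u) struct \<Rightarrow> 'u topology" where
  "line S = mtop S (Univ S) (sdist S)"

definition eucl :: "('f, 'r, 'u) struct \<Rightarrow> nat \<Rightarrow> 'u list topology" where
  "eucl S m = mtop S (pw S m) (\<lambda>xs ys. smax S (map2 (sdist S) xs ys))"


section \<open>Definability and o-minimality\<close>

text \<open>An \<open>L(P)\<close>-formula in variables \<open>'v\<close> is an \<open>L\<close>-formula in variables \<open>'v + 'u\<close>; the free
  variable \<open>Inr c\<close> is the name of the parameter \<open>c\<close>.\<close>

definition definable ::
    "('f, 'r) language \<Rightarrow> ('f, 'r, 'u) struct \<Rightarrow> 'u set \<Rightarrow> nat \<Rightarrow> 'u list set \<Rightarrow> bool" where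
  "definable L S P m A \<longleftrightarrow>
     (\<exists>\<phi> :: ('f, 'r, nat + 'u) fm. is_fm L \<phi> \<and> fv \<phi> \<subseteq> Inl ` {..<m} \<union> Inr ` P \<and>
        A = {xs \<in> pw S m. sat S (case_sum (nth xs) id) \<phi>})"

definition definable_fun ::
    "('f, 'r) language \<Rightarrow> ('f, 'r, 'u) struct \<Rightarrow> 'u set \<Rightarrow> nat \<Rightarrow> 'u list set \<Rightarrow>
      ('u list \<Rightarrow> 'u) \<Rightarrow> bool" where
  "definable_fun L S P m X f \<longleftrightarrow>
     X \<subseteq> pw S m \<and> f ` X \<subseteq> Univ S \<and> definable L S P (Suc m) {xs @ [f xs] |xs. xs \<in> X}"

text \<open>Open intervals; the endpoint \<open>None\<close> stands for minus or plus infinity.\<close>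

definition interval :: "('f, 'r, 'u) struct \<Rightarrow> 'u option \<Rightarrow> 'u option \<Rightarrow> 'u set" where
  "interval S lo up =
     {x \<in> Univ S. (\<forall>l\<in>set_option lo. lt S l x) \<and> (\<forall>u\<in>set_option up. lt S x u)}"

definition o_minimal_struct :: "('f, 'r) language \<Rightarrow> ('f, 'r, 'u) struct \<Rightarrow> bool" where
  "o_minimal_struct L S \<longleftrightarrow>
     (\<forall>A. definable L S (Univ S) 1 A \<longrightarrow>
        (\<exists>F. finite F \<and> {x. [x] \<in> A} = \<Union>F \<and>
           (\<forall>I\<in>F. (\<exists>x\<in>Univ S. I = {x}) \<or>
              (\<exists>lo up. set_option lo \<subseteq> Univ S \<and> set_option up \<subseteq> Univ S \<and> I = interval S lo up))))"

definition o_minimal_theory ::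
    "'u itself \<Rightarrow> ('f, 'r) language \<Rightarrow> ('f, 'r, nat) fm set \<Rightarrow> bool" where
  "o_minimal_theory _ L T \<longleftrightarrow>
     (\<forall>S\<in>(models L T :: ('f, 'r, 'u) struct set). o_minimal_struct L S)"


section \<open>Differentiability\<close>

definition has_partial ::
    "('f, 'r, 'u) struct \<Rightarrow> 'u list set \<Rightarrow> ('u list \<Rightarrow> 'u) \<Rightarrow> nat \<Rightarrow> 'u list \<Rightarrow> 'u \<Rightarrow> bool" where
  "has_partial S U f i u D \<longleftrightarrow> D \<in> Univ S \<and>
     (\<forall>\<epsilon>\<in>Univ S. lt S \<zero>\<^bsub>fld S\<^esub> \<epsilon> \<longrightarrow>
        (\<exists>\<eta>\<in>Univ S. lt S \<zero>\<^bsub>fld S\<^esub> \<eta> \<and>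
           (\<forall>h\<in>Univ S. h \<noteq> \<zero>\<^bsub>fld S\<^esub> \<longrightarrow> lt S (sabs S h) \<eta> \<longrightarrow>
              u[i := u ! i \<oplus>\<^bsub>fld S\<^esub> h] \<in> U \<and>
              lt S (sdist S (f (u[i := u ! i \<oplus>\<^bsub>fld S\<^esub> h]) \<ominus>\<^bsub>fld S\<^esub> f u) (D \<otimes>\<^bsub>fld S\<^esub> h))
                   (\<epsilon> \<otimes>\<^bsub>fld S\<^esub> sabs S h))))"

definition is_jacobian ::
    "('f, 'r, 'u) struct \<Rightarrow> nat \<Rightarrow> 'u list set \<Rightarrow> ('u list \<Rightarrow> 'u) \<Rightarrow> (nat \<Rightarrow> 'u list \<Rightarrow> 'u) \<Rightarrow> bool" where
  "is_jacobian S m U f J \<longleftrightarrow> (\<forall>i<m. \<forall>u\<in>U. has_partial S U f i u (J i u))"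

text \<open>\<open>Cdiff S m U p f\<close>: the set \<open>U\<close> is open in the \<open>m\<close>-th power and \<open>f\<close> is of class
  \<open>C\<^sup>p\<close> on \<open>U\<close>.\<close>

primrec Cdiff ::
    "('f, 'r, 'u) struct \<Rightarrow> nat \<Rightarrow> 'u list set \<Rightarrow> nat \<Rightarrow> ('u list \<Rightarrow> 'u) \<Rightarrow> bool" where
  "Cdiff S m U 0 f \<longleftrightarrow> openin (eucl S m) U \<and>
     continuous_map (subtopology (eucl S m) U) (line S) f"
| "Cdiff S m U (Suc p) f \<longleftrightarrow> openin (eucl S m) U \<and>
     continuous_map (subtopology (eucl S m) U) (line S) f \<and>
     (\<exists>J. is_jacobian S m U f J \<and> (\<forall>i<m. Cdiff S m U p (J i)))"


section \<open>Cells\<close>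

text \<open>Cells in the sense of van den Dries, relative to a class \<open>reg\<close> of admissible functions
  (\<open>reg m X f\<close> for \<open>f\<close> on a subset \<open>X\<close> of the \<open>m\<close>-th power). The first list argument of \<open>cell\<close>
  is the type of the cell, a sequence of zeros and ones whose sum is its dimension.
  A bound \<open>None\<close> of a band is minus or plus infinity.\<close>

inductive cell ::
    "('f, 'r, 'u) struct \<Rightarrow> (nat \<Rightarrow> 'u list set \<Rightarrow> ('u list \<Rightarrow> 'u) \<Rightarrow> bool) \<Rightarrow>
      nat list \<Rightarrow> 'u list set \<Rightarrow> bool" for S reg where
  point: "cell S reg [] {[]}"
| graph: "cell S reg (t @ [0]) {xs @ [f xs] |xs. xs \<in> X}"
    if "cell S reg t X" and "reg (length t) X f"
| band: "cell S reg (t @ [1])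
      {xs @ [y] |xs y. xs \<in> X \<and> y \<in> interval S (map_option (\<lambda>f. f xs) lo) (map_option (\<lambda>g. g xs) up)}"
    if "cell S reg t X"
      and "\<forall>f\<in>set_option lo. reg (length t) X f"
      and "\<forall>g\<in>set_option up. reg (length t) X g"
      and "\<forall>f\<in>set_option lo. \<forall>g\<in>set_option up. \<forall>xs\<in>X. lt S (f xs) (g xs)"

definition cont_fun ::
    "('f, 'r) language \<Rightarrow> ('f, 'r, 'u) struct \<Rightarrow> nat \<Rightarrow> 'u list set \<Rightarrow> ('u list \<Rightarrow> 'u) \<Rightarrow> bool" where
  "cont_fun L S m X f \<longleftrightarrow> definable_fun L S (Univ S) m X f \<and>
     continuous_map (subtopology (eucl S m) X) (line S) f"

text \<open>On a set that is not open, a function is smooth if it extends to a definable smooth function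
  on a definable open neighbourhood.\<close>

definition Cinf_fun ::
    "('f, 'r) language \<Rightarrow> ('f, 'r, 'u) struct \<Rightarrow> nat \<Rightarrow> 'u list set \<Rightarrow> ('u list \<Rightarrow> 'u) \<Rightarrow> bool" where
  "Cinf_fun L S m X f \<longleftrightarrow> definable_fun L S (Univ S) m X f \<and>
     (\<exists>U F. X \<subseteq> U \<and> definable_fun L S (Univ S) m U F \<and> (\<forall>p. Cdiff S m U p F) \<and>
        (\<forall>x\<in>X. F x = f x))"

abbreviation o_minimal_cell ::
    "('f, 'r) language \<Rightarrow> ('f, 'r, 'u) struct \<Rightarrow> nat list \<Rightarrow> 'u list set \<Rightarrow> bool" where
  "o_minimal_cell L S \<equiv> cell S (cont_fun L S)"

abbreviation Cinf_cell ::
    "('f, 'r) language \<Rightarrow> ('f, 'r, 'u) struct \<Rightarrow> nat list \<Rightarrow> 'u list set \<Rightarrow> bool" where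
  "Cinf_cell L S \<equiv> cell S (Cinf_fun L S)"

definition has_dim ::
    "('f, 'r) language \<Rightarrow> ('f, 'r, 'u) struct \<Rightarrow> nat \<Rightarrow> 'u list set \<Rightarrow> nat \<Rightarrow> bool" where
  "has_dim L S m A d \<longleftrightarrow> A \<subseteq> pw S m \<and>
     (\<exists>t B. o_minimal_cell L S t B \<and> B \<subseteq> A \<and> sum_list t = d) \<and>
     (\<forall>t B. o_minimal_cell L S t B \<and> B \<subseteq> A \<longrightarrow> sum_list t \<le> d)"

fun Cinf_decomposition ::
    "('f, 'r) language \<Rightarrow> ('f, 'r, 'u) struct \<Rightarrow> nat \<Rightarrow> 'u list set set \<Rightarrow> bool" where
  "Cinf_decomposition L S 0 \<D> \<longleftrightarrow> \<D> = {{[]}}"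
| "Cinf_decomposition L S (Suc m) \<D> \<longleftrightarrow>
     finite \<D> \<and> \<Union>\<D> = pw S (Suc m) \<and> pairwise disjnt \<D> \<and> (\<forall>B\<in>\<D>. \<exists>t. Cinf_cell L S t B) \<and>
     Cinf_decomposition L S m ((\<lambda>B. butlast ` B) ` \<D>)"

definition admits_Cinf_cell_decomposition ::
    "'u itself \<Rightarrow> ('f, 'r) language \<Rightarrow> ('f, 'r, nat) fm set \<Rightarrow> bool" where
  "admits_Cinf_cell_decomposition _ L T \<longleftrightarrow>
     (\<forall>S\<in>(models L T :: ('f, 'r, 'u) struct set). \<forall>m \<A>.
        finite \<A> \<and> (\<forall>A\<in>\<A>. definable L S (Univ S) m A) \<longrightarrow>
        (\<exists>\<D>. Cinf_decomposition L S m \<D> \<and> (\<forall>A\<in>\<A>. \<forall>B\<in>\<D>. B \<subseteq> A \<or> disjnt B A)))"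


section \<open>Generic derivations\<close>

definition T_derivation ::
    "('f, 'r) language \<Rightarrow> ('f, 'r, 'u) struct \<Rightarrow> ('u \<Rightarrow> 'u) \<Rightarrow> bool" where
  "T_derivation L M \<delta> \<longleftrightarrow> \<delta> ` Univ M \<subseteq> Univ M \<and>
     (\<forall>m U f J. definable_fun L M {} m U f \<and> Cdiff M m U 1 f \<and> is_jacobian M m U f J \<longrightarrow>
        (\<forall>u\<in>U. \<delta> (f u) = (\<Oplus>\<^bsub>fld M\<^esub>i\<in>{..<m}. J i u \<otimes>\<^bsub>fld M\<^esub> \<delta> (u ! i))))"

definition generic_derivation ::
    "('f, 'r) language \<Rightarrow> ('f, 'r, 'u) struct \<Rightarrow> ('u \<Rightarrow> 'u) \<Rightarrow> bool" where
  "generic_derivation L M \<delta> \<longleftrightarrow>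
     (\<forall>m A. definable L M (Univ M) (Suc m) A \<and> has_dim L M m (take m ` A) m \<longrightarrow>
        (\<exists>a\<in>Univ M. map (\<lambda>j. (\<delta> ^^ j) a) [0..<Suc m] \<in> A))"

definition model_Tg_delta ::
    "('f, 'r) language \<Rightarrow> ('f, 'r, nat) fm set \<Rightarrow> ('f, 'r, 'u) struct \<Rightarrow> ('u \<Rightarrow> 'u) \<Rightarrow> bool" where
  "model_Tg_delta L T M \<delta> \<longleftrightarrow>
     M \<in> models L T \<and> T_derivation L M \<delta> \<and> generic_derivation L M \<delta>"


section \<open>Jets and the associated topologies\<close>

text \<open>Multi-indices are lists of length \<open>k\<close>. The space \<open>E\<^sub>n\<close> is the power of the universe
  with exponent \<open>jlen n\<close>, and its coordinate \<open>x\<^sub>i\<^sup>(\<^sup>j\<^sup>)\<close> is the one with index \<open>jpos n i j\<close>;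
  indices start at zero.\<close>

definition jlen :: "nat list \<Rightarrow> nat" where
  "jlen n = sum_list (map Suc n)"

definition jpos :: "nat list \<Rightarrow> nat \<Rightarrow> nat \<Rightarrow> nat" where
  "jpos n i j = jlen (take i n) + j"

definition Jet :: "('u \<Rightarrow> 'u) \<Rightarrow> nat list \<Rightarrow> 'u list \<Rightarrow> 'u list" where
  "Jet \<delta> n a = concat (map (\<lambda>i. map (\<lambda>j. (\<delta> ^^ j) (a ! i)) [0..<Suc (n ! i)]) [0..<length n])"

definition E :: "('f, 'r, 'u) struct \<Rightarrow> nat list \<Rightarrow> 'u list topology" where
  "E M n = eucl M (jlen n)"

definition jdist ::
    "('f, 'r, 'u) struct \<Rightarrow> ('u \<Rightarrow> 'u) \<Rightarrow> nat list \<Rightarrow> 'u list \<Rightarrow> 'u list \<Rightarrow> 'u" where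
  "jdist M \<delta> n a b =
     smax M [sdist M ((\<delta> ^^ j) (a ! i)) ((\<delta> ^^ j) (b ! i)). i \<leftarrow> [0..<length n], j \<leftarrow> [0..<Suc (n ! i)]]"

definition Ttop :: "('f, 'r, 'u) struct \<Rightarrow> ('u \<Rightarrow> 'u) \<Rightarrow> nat list \<Rightarrow> 'u list topology" where
  "Ttop M \<delta> n = mtop M (pw M (length n)) (jdist M \<delta> n)"

text \<open>The union of the topologies \<open>Ttop M \<delta> n\<close> is closed under finite intersections but need not
  be closed under arbitrary unions; it is a base of the \<open>\<delta>\<close>-topology.\<close>

definition delta_top :: "('f, 'r, 'u) struct \<Rightarrow> ('u \<Rightarrow> 'u) \<Rightarrow> nat \<Rightarrow> 'u list topology" where
  "delta_top M \<delta> k = topology_generated_by (\<Union>n\<in>{n. length n = k}. {U. openin (Ttop M \<delta> n) U})"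


section \<open>Delta-cells\<close>

text \<open>A quantifier-free \<open>L\<^sup>\<delta>(M)\<close>-formula in which \<open>\<delta>\<close> is applied to variables only is an
  \<open>L(M)\<close>-formula in the variables \<open>\<delta>\<^sup>j x\<^sub>i\<close>, represented here by \<open>Inl (i, j)\<close>. Passing from the
  formula to its \<open>L\<close>-reading in \<open>E\<^sub>n\<close> is then a change of valuation.\<close>

type_synonym ('f, 'r, 'u) dfm = "('f, 'r, nat \<times> nat + 'u) fm"

definition is_dfm ::
    "('f, 'r) language \<Rightarrow> ('f, 'r, 'u) struct \<Rightarrow> nat \<Rightarrow> ('f, 'r, 'u) dfm \<Rightarrow> bool" where
  "is_dfm L M k \<phi> \<longleftrightarrow> is_fm L \<phi> \<and> qfree \<phi> \<and> fv \<phi> \<subseteq> Inl ` ({..<k} \<times> UNIV) \<union> Inr ` Univ M"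

definition dset ::
    "('f, 'r, 'u) struct \<Rightarrow> ('u \<Rightarrow> 'u) \<Rightarrow> nat \<Rightarrow> ('f, 'r, 'u) dfm \<Rightarrow> 'u list set" where
  "dset M \<delta> k \<phi> = {a \<in> pw M k. sat M (case_sum (\<lambda>(i, j). (\<delta> ^^ j) (a ! i)) id) \<phi>}"

definition ord :: "nat \<Rightarrow> ('f, 'r, 'u) dfm \<Rightarrow> nat list" where
  "ord k \<phi> = map (\<lambda>i. Max (insert 0 {j. Inl (i, j) \<in> fv \<phi>})) [0..<k]"

definition Lset :: "('f, 'r, 'u) struct \<Rightarrow> nat \<Rightarrow> ('f, 'r, 'u) dfm \<Rightarrow> 'u list set" where
  "Lset M k \<phi> = {z \<in> pw M (jlen (ord k \<phi>)).
     sat M (case_sum (\<lambda>(i, j). z ! jpos (ord k \<phi>) i j) id) \<phi>}"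

definition source_formula ::
    "('f, 'r) language \<Rightarrow> ('f, 'r, 'u) struct \<Rightarrow> ('u \<Rightarrow> 'u) \<Rightarrow> nat \<Rightarrow> 'u list set \<Rightarrow>
      ('f, 'r, 'u) dfm \<Rightarrow> bool" where
  "source_formula L M \<delta> k C \<phi> \<longleftrightarrow>
     is_dfm L M k \<phi> \<and> dset M \<delta> k \<phi> = C \<and>
     (\<exists>t. o_minimal_cell L M t (Lset M k \<phi>)) \<and>
     Lset M k \<phi> =
       (subtopology (E M (ord k \<phi>)) (Lset M k \<phi>) closure_of (Jet \<delta> (ord k \<phi>) ` C))"

definition delta_cell ::
    "('f, 'r) language \<Rightarrow> ('f, 'r, 'u) struct \<Rightarrow> ('u \<Rightarrow> 'u) \<Rightarrow> nat \<Rightarrow> 'u list set \<Rightarrow> bool" where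
  "delta_cell L M \<delta> k C \<longleftrightarrow> (\<exists>\<phi>. source_formula L M \<delta> k C \<phi>)"

definition revlex_less :: "nat list \<Rightarrow> nat list \<Rightarrow> bool" where
  "revlex_less m n \<longleftrightarrow>
     length m = length n \<and>
     (\<exists>i<length n. m ! i < n ! i \<and> (\<forall>l. i < l \<and> l < length n \<longrightarrow> m ! l = n ! l))"

definition delta_cell_order ::
    "('f, 'r) language \<Rightarrow> ('f, 'r, 'u) struct \<Rightarrow> ('u \<Rightarrow> 'u) \<Rightarrow> nat \<Rightarrow> 'u list set \<Rightarrow>
      nat list \<Rightarrow> bool" where
  "delta_cell_order L M \<delta> k C n \<longleftrightarrow>
     (\<exists>\<phi>. source_formula L M \<delta> k C \<phi> \<and> ord k \<phi> = n) \<and>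
     (\<forall>\<psi>. source_formula L M \<delta> k C \<psi> \<longrightarrow> ord k \<psi> = n \<or> revlex_less n (ord k \<psi>))"

end

theory Submission
  imports Defs
begin

text \<open>The map \<open>Jet\<close> is an isometry from \<open>d\<^sub>n\<close> to the sup metric of \<open>E\<^sub>n\<close>, so
  closeness to a set is the same condition on either side. Since \<open>d\<^sub>m \<le> d\<^sub>n\<close> whenever
  \<open>m \<le> n\<close> coordinatewise, the topologies of the shifts of \<open>n\<close> form a cofinal chain and their
  open sets are a base of the \<open>\<delta>\<close>-topology.\<close>

section \<open>Jets as lists and the jet metric\<close>

lemma map2_concat_map:
  "map2 f (concat (map (\<lambda>i. map (g i) (h i)) is)) (concat (map (\<lambda>i. map (g' i) (h i)) is)) =
   concat (map (\<lambda>i. map (\<lambda>j. f (g i j) (g' i j)) (h i)) is)"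
  \<comment> \<open>The blocks of both lists run over the same \<open>h i\<close>, so
    \<open>zip\<close> never pairs entries across a block boundary.\<close>
  by (induction "is") (auto simp: zip_map_map zip_same_conv_map)

lemma jdist_eq_Jet:
  "jdist M \<delta> n a b = smax M (map2 (sdist M) (Jet \<delta> n a) (Jet \<delta> n b))"
  unfolding jdist_def Jet_def by (subst map2_concat_map) simp

lemma length_Jet: "length (Jet \<delta> n a) = jlen n"
proof -
  have "length (Jet \<delta> n a) = sum_list (map (\<lambda>i. Suc (n ! i)) [0..<length n])"
    unfolding Jet_def by (simp add: length_concat comp_def)
  also have "map (\<lambda>i. Suc (n ! i)) [0..<length n] = map Suc n"
    by (rule nth_equalityI) auto
  finally show ?thesis by (simp add: jlen_def)
qed

lemma funpow_closed: "f ` A \<subseteq> A \<Longrightarrow> x \<in> A \<Longrightarrow> (f ^^ j) x \<in> A"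
  by (induction j) auto

lemma funpow_nth_closed:
  assumes "\<delta> ` Univ M \<subseteq> Univ M" "a \<in> pw M k" "i < k"
  shows "(\<delta> ^^ j) (a ! i) \<in> Univ M"
  using assms by (intro funpow_closed) (auto simp: pw_def)

lemma Jet_in_pw:
  assumes "\<delta> ` Univ M \<subseteq> Univ M" "a \<in> pw M (length n)"
  shows "Jet \<delta> n a \<in> pw M (jlen n)"
proof -
  have "set (Jet \<delta> n a) \<subseteq> Univ M"
    unfolding Jet_def using funpow_nth_closed[OF assms] by auto
  then show ?thesis by (simp add: pw_def length_Jet)
qed

section \<open>Order, absolute value and distance in an ordered field\<close>

context
  fixes S :: "('f, 'r, 'u) struct"
  assumes ordered_field: "is_ordered_field S"
begin

interpretation F: field "fld S"
  using ordered_field by (simp add: is_ordered_field_def)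

lemma carrier_fld: "carrier (fld S) = Univ S"
  by (simp add: fld_def)

lemma lt_irrefl: "x \<in> Univ S \<Longrightarrow> \<not> lt S x x"
  using ordered_field unfolding is_ordered_field_def by blast

lemma lt_trans: "lt S x y \<Longrightarrow> lt S y z \<Longrightarrow> x \<in> Univ S \<Longrightarrow> y \<in> Univ S \<Longrightarrow> z \<in> Univ S \<Longrightarrow> lt S x z"
  using ordered_field unfolding is_ordered_field_def by blast

lemma lt_linear: "x \<in> Univ S \<Longrightarrow> y \<in> Univ S \<Longrightarrow> lt S x y \<or> x = y \<or> lt S y x"
  using ordered_field unfolding is_ordered_field_def by blast

lemma add_right_mono:
  "lt S x y \<Longrightarrow> x \<in> Univ S \<Longrightarrow> y \<in> Univ S \<Longrightarrow> z \<in> Univ S \<Longrightarrow>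
   lt S (x \<oplus>\<^bsub>fld S\<^esub> z) (y \<oplus>\<^bsub>fld S\<^esub> z)"
  using ordered_field unfolding is_ordered_field_def by blast

lemma zero_closed: "\<zero>\<^bsub>fld S\<^esub> \<in> Univ S"
  and add_closed: "x \<in> Univ S \<Longrightarrow> y \<in> Univ S \<Longrightarrow> x \<oplus>\<^bsub>fld S\<^esub> y \<in> Univ S"
  and neg_closed: "x \<in> Univ S \<Longrightarrow> \<ominus>\<^bsub>fld S\<^esub> x \<in> Univ S"
  and diff_closed: "x \<in> Univ S \<Longrightarrow> y \<in> Univ S \<Longrightarrow> x \<ominus>\<^bsub>fld S\<^esub> y \<in> Univ S"
  using F.zero_closed F.a_closed F.a_inv_closed F.minus_closed unfolding carrier_fld by auto

lemmas fld_closed = zero_closed add_closed neg_closed diff_closed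

text \<open>Only the strict relation \<open>lt\<close> is given; here and below
  \<open>\<not> lt S y x\<close> stands for x \<le> y.\<close>

lemma not_lt_trans:
  assumes "\<not> lt S y x" "lt S y z" "x \<in> Univ S" "y \<in> Univ S" "z \<in> Univ S"
  shows "lt S x z"
  using lt_linear[OF assms(3,4)] lt_trans[OF _ assms(2,3,4,5)] assms(1,2) by auto

text \<open>One is nonzero, so it or its negative is positive. Either serves: the element is wanted
  as a radius that shows the whole space to be open in \<open>mtop\<close>.\<close>

lemma exists_pos: "\<exists>e\<in>Univ S. lt S \<zero>\<^bsub>fld S\<^esub> e"
proof -
  let ?u = "\<one>\<^bsub>fld S\<^esub>"
  have u: "?u \<in> Univ S" using F.one_closed unfolding carrier_fld .
  have "?u \<noteq> \<zero>\<^bsub>fld S\<^esub>" by simp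
  then consider "lt S \<zero>\<^bsub>fld S\<^esub> ?u" | "lt S ?u \<zero>\<^bsub>fld S\<^esub>"
    using lt_linear[OF u zero_closed] by blast
  then show ?thesis
  proof cases
    case 2
    then have "lt S (?u \<oplus>\<^bsub>fld S\<^esub> \<ominus>\<^bsub>fld S\<^esub> ?u) (\<zero>\<^bsub>fld S\<^esub> \<oplus>\<^bsub>fld S\<^esub> \<ominus>\<^bsub>fld S\<^esub> ?u)"
      by (intro add_right_mono fld_closed u)
    then show ?thesis using neg_closed[OF u] by (auto simp: F.r_neg)
  qed (use u in blast)
qed

lemma add_strict_mono:
  assumes "\<not> lt S y x" "lt S z w" "x \<in> Univ S" "y \<in> Univ S" "z \<in> Univ S" "w \<in> Univ S"
  shows "lt S (x \<oplus>\<^bsub>fld S\<^esub> z) (y \<oplus>\<^bsub>fld S\<^esub> w)"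
proof -
  have less: "lt S (y \<oplus>\<^bsub>fld S\<^esub> z) (y \<oplus>\<^bsub>fld S\<^esub> w)"
    using add_right_mono[OF assms(2,5,6,4)] assms(4-6) F.a_comm unfolding carrier_fld by simp
  have "x = y \<or> lt S x y" using lt_linear[OF assms(3,4)] assms(1) by blast
  then show ?thesis
  proof
    assume "lt S x y"
    from add_right_mono[OF this assms(3,4,5)] less show ?thesis
      by (rule lt_trans) (intro add_closed assms)+
  qed (use less in simp)
qed

lemma neg_iff_uminus_pos:
  assumes x: "x \<in> Univ S"
  shows "lt S x \<zero>\<^bsub>fld S\<^esub> \<longleftrightarrow> lt S \<zero>\<^bsub>fld S\<^esub> (\<ominus>\<^bsub>fld S\<^esub> x)"
  using add_right_mono[OF _ x zero_closed neg_closed[OF x]]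
    add_right_mono[OF _ zero_closed neg_closed[OF x] x] x neg_closed[OF x]
  by (auto simp: carrier_fld F.r_neg F.l_neg)

text \<open>\<open>sabs S x\<close> is the larger of x and its negative. Estimates thus become pairs
  of linear inequalities, and later arguments need no case distinction on signs.\<close>

lemma sabs_less_iff:
  assumes x: "x \<in> Univ S" and e: "e \<in> Univ S"
  shows "lt S (sabs S x) e \<longleftrightarrow> lt S x e \<and> lt S (\<ominus>\<^bsub>fld S\<^esub> x) e"
proof (cases "lt S x \<zero>\<^bsub>fld S\<^esub>")
  case True
  then have "lt S x (\<ominus>\<^bsub>fld S\<^esub> x)"
    using lt_trans[OF True _ x zero_closed neg_closed[OF x]] neg_iff_uminus_pos[OF x] by blast
  then show ?thesis
    using True lt_trans[OF _ _ x neg_closed[OF x] e] unfolding sabs_def by auto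
next
  case False
  then have "\<not> lt S x (\<ominus>\<^bsub>fld S\<^esub> x)"
    using not_lt_trans[OF False _ zero_closed x neg_closed[OF x]] neg_iff_uminus_pos[OF x] by blast
  then show ?thesis
    using False not_lt_trans[OF _ _ neg_closed[OF x] x e] unfolding sabs_def by auto
qed

text \<open>With \<open>e\<close> chosen as x or as its negative, \<open>sabs_less_iff\<close> would
  make that element less than itself.\<close>

lemma sabs_ge:
  assumes x: "x \<in> Univ S"
  shows "\<not> lt S (sabs S x) x" "\<not> lt S (sabs S x) (\<ominus>\<^bsub>fld S\<^esub> x)"
  using sabs_less_iff[OF x x] sabs_less_iff[OF x neg_closed[OF x]]
    lt_irrefl[OF x] lt_irrefl[OF neg_closed[OF x]] by auto

lemma sabs_closed: "x \<in> Univ S \<Longrightarrow> sabs S x \<in> Univ S"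
  unfolding sabs_def by (simp add: fld_closed)

lemma sdist_closed: "x \<in> Univ S \<Longrightarrow> y \<in> Univ S \<Longrightarrow> sdist S x y \<in> Univ S"
  unfolding sdist_def by (intro sabs_closed fld_closed)

lemma sdist_self: "x \<in> Univ S \<Longrightarrow> sdist S x x = \<zero>\<^bsub>fld S\<^esub>"
  unfolding sdist_def sabs_def
  by (simp add: F.r_neg a_minus_def carrier_fld lt_irrefl zero_closed)

text \<open>One bound is weak and the other strict because \<open>s\<close> is going to be a maximum
  of distances and \<open>t\<close> the radius of a ball. The bounds are added once for the
  difference and once for its negative.\<close>

lemma sdist_triangle_less:
  assumes "x \<in> Univ S" "y \<in> Univ S" "z \<in> Univ S" and s: "s \<in> Univ S" and t: "t \<in> Univ S"
    and xy: "\<not> lt S s (sdist S x y)" and yz: "lt S (sdist S y z) t"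
  shows "lt S (sdist S x z) (s \<oplus>\<^bsub>fld S\<^esub> t)"
proof -
  let ?p = "x \<ominus>\<^bsub>fld S\<^esub> y" and ?q = "y \<ominus>\<^bsub>fld S\<^esub> z" and ?d = "x \<ominus>\<^bsub>fld S\<^esub> z"
  have p: "?p \<in> Univ S" and q: "?q \<in> Univ S" and d: "?d \<in> Univ S"
    using assms(1-3) by (auto intro: diff_closed)
  have sum: "?d = ?p \<oplus>\<^bsub>fld S\<^esub> ?q" "\<ominus>\<^bsub>fld S\<^esub> ?d = \<ominus>\<^bsub>fld S\<^esub> ?p \<oplus>\<^bsub>fld S\<^esub> \<ominus>\<^bsub>fld S\<^esub> ?q"
    using assms(1-3) unfolding carrier_fld[symmetric] by algebra+
  have "\<not> lt S s ?p"
    using sabs_ge(1)[OF p] xy lt_linear[OF s sabs_closed[OF p]]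
      lt_trans[OF _ _ sabs_closed[OF p] s p] unfolding sdist_def by auto
  moreover have "\<not> lt S s (\<ominus>\<^bsub>fld S\<^esub> ?p)"
    using sabs_ge(2)[OF p] xy lt_linear[OF s sabs_closed[OF p]]
      lt_trans[OF _ _ sabs_closed[OF p] s neg_closed[OF p]] unfolding sdist_def by auto
  moreover have "lt S ?q t" "lt S (\<ominus>\<^bsub>fld S\<^esub> ?q) t"
    using yz sabs_less_iff[OF q t] unfolding sdist_def by auto
  \<comment> \<open>The equation for the negative is unfolded first: its left side contains
    \<open>?d\<close>, which the other rewriting would replace.\<close>
  ultimately have "lt S ?d (s \<oplus>\<^bsub>fld S\<^esub> t)" "lt S (\<ominus>\<^bsub>fld S\<^esub> ?d) (s \<oplus>\<^bsub>fld S\<^esub> t)"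
    unfolding sum(2) unfolding sum(1) using add_strict_mono[OF _ _ p s q t]
      add_strict_mono[OF _ _ neg_closed[OF p] s neg_closed[OF q] t] by auto
  then show ?thesis
    unfolding sdist_def using sabs_less_iff[OF d add_closed[OF s t]] by blast
qed

section \<open>Maxima of finite lists\<close>

lemma smax_closed: "set xs \<subseteq> Univ S \<Longrightarrow> smax S xs \<in> Univ S"
  unfolding smax_def by (induction xs) (auto simp: zero_closed)

text \<open>The fold starts at zero, so zero competes with the entries. This is the source of the
  condition that \<open>e\<close> is positive, the only one that remains for the empty list.\<close>

lemma smax_less_iff:
  assumes "set xs \<subseteq> Univ S" "e \<in> Univ S"
  shows "lt S (smax S xs) e \<longleftrightarrow> lt S \<zero>\<^bsub>fld S\<^esub> e \<and> (\<forall>x\<in>set xs. lt S x e)"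
  using assms(1)
proof (induction xs)
  case Nil
  then show ?case by (simp add: smax_def)
next
  case (Cons x xs)
  let ?m = "smax S xs"
  have m: "?m \<in> Univ S" "x \<in> Univ S" using Cons.prems by (auto intro: smax_closed)
  have "smax S (x # xs) = (if lt S x ?m then ?m else x)" by (simp add: smax_def)
  then have "lt S (smax S (x # xs)) e \<longleftrightarrow> lt S ?m e \<and> lt S x e"
    using m assms(2) lt_trans[of x ?m e] not_lt_trans[of x ?m e] by auto
  then show ?case using Cons by auto
qed

text \<open>Otherwise \<open>smax_less_iff\<close> with \<open>e\<close> equal to the entry x would
  give x < x.\<close>

lemma smax_ge: "set xs \<subseteq> Univ S \<Longrightarrow> x \<in> set xs \<Longrightarrow> \<not> lt S (smax S xs) x"
  using smax_less_iff[of xs x] lt_irrefl[of x] by auto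

section \<open>Topologies of metrics with values in an ordered field\<close>

lemma openin_mtop:
  assumes "\<And>x y. x \<in> X \<Longrightarrow> y \<in> X \<Longrightarrow> d x y \<in> Univ S"
  shows "openin (mtop S X d) U \<longleftrightarrow> U \<subseteq> X \<and>
     (\<forall>x\<in>U. \<exists>\<epsilon>\<in>Univ S. lt S \<zero>\<^bsub>fld S\<^esub> \<epsilon> \<and> (\<forall>y\<in>X. lt S (d x y) \<epsilon> \<longrightarrow> y \<in> U))"
  unfolding mtop_def
  by (subst topology_inverse'[OF istopology_mtop[OF ordered_field]]) (auto intro: assms)

lemma topspace_mtop:
  assumes "\<And>x y. x \<in> X \<Longrightarrow> y \<in> X \<Longrightarrow> d x y \<in> Univ S"
  shows "topspace (mtop S X d) = X"
proof -
  have "openin (mtop S X d) X" using exists_pos by (subst openin_mtop) (auto intro: assms)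
  moreover have "topspace (mtop S X d) \<subseteq> X"
    using openin_topspace[of "mtop S X d"] by (subst (asm) openin_mtop) (auto intro: assms)
  ultimately show ?thesis using openin_subset by blast
qed

text \<open>Open sets of \<open>mtop\<close> are those containing a ball around each of their
  points, so it has to be derived that balls are open; the triangle inequality enters there. Balls
  around \<open>a\<close> then suffice to test membership in the closure.\<close>

lemma in_closure_of_mtop:
  assumes d: "\<And>x y. x \<in> X \<Longrightarrow> y \<in> X \<Longrightarrow> d x y \<in> Univ S"
    and self: "\<And>x. x \<in> X \<Longrightarrow> d x x = \<zero>\<^bsub>fld S\<^esub>"
    and triangle: "\<And>x y z t. x \<in> X \<Longrightarrow> y \<in> X \<Longrightarrow> z \<in> X \<Longrightarrow> t \<in> Univ S \<Longrightarrow>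
      lt S \<zero>\<^bsub>fld S\<^esub> t \<Longrightarrow> lt S (d y z) t \<Longrightarrow> lt S (d x z) (d x y \<oplus>\<^bsub>fld S\<^esub> t)"
  shows "a \<in> mtop S X d closure_of C \<longleftrightarrow>
    a \<in> X \<and> (\<forall>e\<in>Univ S. lt S \<zero>\<^bsub>fld S\<^esub> e \<longrightarrow> (\<exists>y\<in>C \<inter> X. lt S (d a y) e))"
proof -
  have opn: "openin (mtop S X d) U \<longleftrightarrow> U \<subseteq> X \<and>
       (\<forall>x\<in>U. \<exists>\<epsilon>\<in>Univ S. lt S \<zero>\<^bsub>fld S\<^esub> \<epsilon> \<and> (\<forall>y\<in>X. lt S (d x y) \<epsilon> \<longrightarrow> y \<in> U))" for U
    using d by (rule openin_mtop)
  have top: "topspace (mtop S X d) = X"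
    using d by (rule topspace_mtop)
  have ball: "openin (mtop S X d) {y \<in> X. lt S (d x y) e}" if xe: "x \<in> X" "e \<in> Univ S" for x e
    unfolding opn
  proof (intro conjI ballI)
    fix y assume "y \<in> {y \<in> X. lt S (d x y) e}"
    then have y: "y \<in> X" "lt S (d x y) e" by auto
    \<comment> \<open>The room left around y inside the ball: adding the negative of
      \<open>d x y\<close> to \<open>d x y < e\<close> shows that it is positive, and the triangle
      inequality then gives the bound \<open>e\<close> exactly.\<close>
    let ?t = "e \<ominus>\<^bsub>fld S\<^esub> d x y"
    have dxy: "d x y \<in> Univ S" using d xe y by blast
    have eq: "d x y \<oplus>\<^bsub>fld S\<^esub> ?t = e" "d x y \<oplus>\<^bsub>fld S\<^esub> \<ominus>\<^bsub>fld S\<^esub> d x y = \<zero>\<^bsub>fld S\<^esub>"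
      using dxy xe unfolding carrier_fld[symmetric] by algebra+
    have t: "?t \<in> Univ S" using dxy xe by (intro fld_closed)
    have "lt S \<zero>\<^bsub>fld S\<^esub> ?t"
      using add_right_mono[OF y(2) dxy xe(2) neg_closed[OF dxy]] eq by (simp add: a_minus_def)
    then show "\<exists>\<epsilon>\<in>Univ S. lt S \<zero>\<^bsub>fld S\<^esub> \<epsilon> \<and>
        (\<forall>z\<in>X. lt S (d y z) \<epsilon> \<longrightarrow> z \<in> {y \<in> X. lt S (d x y) e})"
      using t triangle[OF xe(1) y(1) _ t] eq by (intro bexI[of _ ?t]) auto
  qed auto
  show ?thesis
    unfolding in_closure_of top
  proof (intro conj_cong iffI ballI impI allI refl; (elim conjE)?)
    fix e assume "a \<in> X" "\<forall>U. a \<in> U \<and> openin (mtop S X d) U \<longrightarrow> (\<exists>y. y \<in> C \<and> y \<in> U)"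
      "e \<in> Univ S" "lt S \<zero>\<^bsub>fld S\<^esub> e"
    \<comment> \<open>The open set to test against is the ball around \<open>a\<close>; it contains
      \<open>a\<close> since \<open>d a a\<close> is zero.\<close>
    then show "\<exists>y\<in>C \<inter> X. lt S (d a y) e"
      using ball[of a e] self by (auto dest!: spec[of _ "{y \<in> X. lt S (d a y) e}"])
  next
    fix U assume "\<forall>e\<in>Univ S. lt S \<zero>\<^bsub>fld S\<^esub> e \<longrightarrow> (\<exists>y\<in>C \<inter> X. lt S (d a y) e)"
      "a \<in> U" "openin (mtop S X d) U"
    then show "\<exists>y. y \<in> C \<and> y \<in> U"
      unfolding opn by blast
  qed
qed

section \<open>The sup metric on powers\<close>

lemma set_map2_sdist:
  assumes "xs \<in> pw S m" "ys \<in> pw S m"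
  shows "set (map2 (sdist S) xs ys) = (\<lambda>i. sdist S (xs ! i) (ys ! i)) ` {..<m}"
  using assms unfolding pw_def by (auto simp: set_zip)

lemma sup_dist_closed:
  assumes "xs \<in> pw S m" "ys \<in> pw S m"
  shows "set (map2 (sdist S) xs ys) \<subseteq> Univ S" "smax S (map2 (sdist S) xs ys) \<in> Univ S"
proof -
  show "set (map2 (sdist S) xs ys) \<subseteq> Univ S"
    unfolding set_map2_sdist[OF assms] using assms
    by (auto simp: pw_def intro!: sdist_closed)
  then show "smax S (map2 (sdist S) xs ys) \<in> Univ S" by (rule smax_closed)
qed

lemma sup_dist_self:
  assumes "xs \<in> pw S m"
  shows "smax S (map2 (sdist S) xs xs) = \<zero>\<^bsub>fld S\<^esub>"
proof -
  have "map2 (sdist S) xs xs = replicate m \<zero>\<^bsub>fld S\<^esub>"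
    using assms by (intro nth_equalityI) (auto simp: pw_def intro!: sdist_self)
  moreover have "smax S (replicate m \<zero>\<^bsub>fld S\<^esub>) = \<zero>\<^bsub>fld S\<^esub>"
    unfolding smax_def by (induction m) auto
  ultimately show ?thesis by simp
qed

text \<open>The inequality is checked in each coordinate, where the first distance is at most the
  maximum \<open>?s\<close> and the second is below \<open>t\<close>. The maximum of finitely many
  entries below a positive bound is again below it.\<close>

lemma sup_dist_triangle_less:
  assumes "xs \<in> pw S m" "ys \<in> pw S m" "zs \<in> pw S m" "t \<in> Univ S" "lt S \<zero>\<^bsub>fld S\<^esub> t"
    and "lt S (smax S (map2 (sdist S) ys zs)) t"
  shows "lt S (smax S (map2 (sdist S) xs zs)) (smax S (map2 (sdist S) xs ys) \<oplus>\<^bsub>fld S\<^esub> t)"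
proof -
  let ?s = "smax S (map2 (sdist S) xs ys)"
  note s = sup_dist_closed[OF assms(1,2)]
  have nonneg: "\<not> lt S ?s \<zero>\<^bsub>fld S\<^esub>"
    using smax_less_iff[OF s(1) zero_closed] lt_irrefl zero_closed by blast
  have yz: "\<forall>i<m. lt S (sdist S (ys ! i) (zs ! i)) t"
    using assms(6) smax_less_iff[OF sup_dist_closed(1)[OF assms(2,3)] assms(4)]
    unfolding set_map2_sdist[OF assms(2,3)] by auto
  have xy: "\<not> lt S ?s (sdist S (xs ! i) (ys ! i))" if "i < m" for i
    using smax_ge[OF s(1)] that unfolding set_map2_sdist[OF assms(1,2)] by blast
  have "lt S (sdist S (xs ! i) (zs ! i)) (?s \<oplus>\<^bsub>fld S\<^esub> t)" if "i < m" for i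
    using assms(1-3) that xy[OF that] yz
    by (intro sdist_triangle_less[of "xs ! i" "ys ! i"] s(2) assms(4)) (auto simp: pw_def)
  \<comment> \<open>Zero counts as an entry of \<open>smax\<close>, so the bound must also be shown
    positive; this covers the case of no coordinates as well.\<close>
  moreover have "lt S \<zero>\<^bsub>fld S\<^esub> (?s \<oplus>\<^bsub>fld S\<^esub> t)"
    using add_strict_mono[OF nonneg assms(5) zero_closed s(2) zero_closed assms(4)]
    by simp
  ultimately show ?thesis
    using smax_less_iff[OF sup_dist_closed(1)[OF assms(1,3)] add_closed[OF s(2) assms(4)]]
    unfolding set_map2_sdist[OF assms(1,3)] by auto
qed

lemma in_closure_of_eucl:
  "z \<in> eucl S m closure_of A \<longleftrightarrow> z \<in> pw S m \<and>
    (\<forall>e\<in>Univ S. lt S \<zero>\<^bsub>fld S\<^esub> e \<longrightarrow> (\<exists>y\<in>A \<inter> pw S m. lt S (smax S (map2 (sdist S) z y)) e))"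
  unfolding eucl_def
  by (rule in_closure_of_mtop)
    (blast intro: sup_dist_closed(2) sup_dist_self sup_dist_triangle_less)+

section \<open>Jet topologies and their closures\<close>

lemma jdist_closed:
  assumes "\<delta> ` Univ S \<subseteq> Univ S" "a \<in> pw S (length n)" "b \<in> pw S (length n)"
  shows "jdist S \<delta> n a b \<in> Univ S"
  unfolding jdist_eq_Jet by (intro sup_dist_closed(2)[where m = "jlen n"] Jet_in_pw assms)

text \<open>Spelling the maximum out over pairs (i, j) lets metrics of different orders be compared
  by inclusion of their index ranges. The range of j includes \<open>n ! i\<close>, as a jet of
  order n has n + 1 entries.\<close>

lemma jdist_less_iff:
  assumes "\<delta> ` Univ S \<subseteq> Univ S" "a \<in> pw S (length n)" "b \<in> pw S (length n)" "e \<in> Univ S"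
  shows "lt S (jdist S \<delta> n a b) e \<longleftrightarrow> lt S \<zero>\<^bsub>fld S\<^esub> e \<and>
    (\<forall>i<length n. \<forall>j\<le>n ! i. lt S (sdist S ((\<delta> ^^ j) (a ! i)) ((\<delta> ^^ j) (b ! i))) e)"
  unfolding jdist_def
proof (subst smax_less_iff)
  show "set [sdist S ((\<delta> ^^ j) (a ! i)) ((\<delta> ^^ j) (b ! i)).
      i \<leftarrow> [0..<length n], j \<leftarrow> [0..<Suc (n ! i)]] \<subseteq> Univ S"
    using funpow_nth_closed[OF assms(1,2)] funpow_nth_closed[OF assms(1,3)]
    by (auto intro!: sdist_closed)
qed (use assms(4) in \<open>auto simp: less_Suc_eq_le simp del: upt_Suc\<close>)

text \<open>The metric laws for \<open>jdist\<close> are those of the sup metric pulled back along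
  \<open>Jet\<close>, whose values lie in the right power because \<delta> maps the universe into
  itself.\<close>

lemma in_closure_of_Ttop:
  assumes "\<delta> ` Univ S \<subseteq> Univ S"
  shows "a \<in> Ttop S \<delta> n closure_of C \<longleftrightarrow> a \<in> pw S (length n) \<and>
    (\<forall>e\<in>Univ S. lt S \<zero>\<^bsub>fld S\<^esub> e \<longrightarrow> (\<exists>y\<in>C \<inter> pw S (length n). lt S (jdist S \<delta> n a y) e))"
  unfolding Ttop_def jdist_eq_Jet
proof (rule in_closure_of_mtop)
  note J = Jet_in_pw[OF assms]
  show "smax S (map2 (sdist S) (Jet \<delta> n x) (Jet \<delta> n y)) \<in> Univ S"
    if "x \<in> pw S (length n)" "y \<in> pw S (length n)" for x y
    using J[OF that(1)] J[OF that(2)] by (rule sup_dist_closed(2))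
  show "smax S (map2 (sdist S) (Jet \<delta> n x) (Jet \<delta> n x)) = \<zero>\<^bsub>fld S\<^esub>"
    if "x \<in> pw S (length n)" for x
    using J[OF that] by (rule sup_dist_self)
  show "lt S (smax S (map2 (sdist S) (Jet \<delta> n x) (Jet \<delta> n z)))
      (smax S (map2 (sdist S) (Jet \<delta> n x) (Jet \<delta> n y)) \<oplus>\<^bsub>fld S\<^esub> t)"
    if "x \<in> pw S (length n)" "y \<in> pw S (length n)" "z \<in> pw S (length n)" "t \<in> Univ S"
      "lt S \<zero>\<^bsub>fld S\<^esub> t" "lt S (smax S (map2 (sdist S) (Jet \<delta> n y) (Jet \<delta> n z))) t" for x y z t
    using J[OF that(1)] J[OF that(2)] J[OF that(3)] that(4-6) by (rule sup_dist_triangle_less)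
qed

lemma Ttop_closure_iff_Jet:
  assumes "\<delta> ` Univ S \<subseteq> Univ S" "a \<in> pw S (length n)" "C \<subseteq> pw S (length n)"
  shows "a \<in> Ttop S \<delta> n closure_of C \<longleftrightarrow> Jet \<delta> n a \<in> E S n closure_of (Jet \<delta> n ` C)"
proof -
  \<comment> \<open>The metric descriptions of closure intersect with the ambient space. Here both
    intersections are vacuous, and what remains on either side is the same condition on points of
    \<open>C\<close>.\<close>
  have "Jet \<delta> n ` C \<inter> pw S (jlen n) = Jet \<delta> n ` C" "C \<inter> pw S (length n) = C"
    using assms Jet_in_pw by blast+
  then show ?thesis
    unfolding E_def in_closure_of_eucl in_closure_of_Ttop[OF assms(1)] jdist_eq_Jet
    using assms(2) Jet_in_pw[OF assms(1,2)] by simp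
qed

section \<open>Comparison of the jet topologies and the \<delta>-topology\<close>

lemma openin_Ttop:
  assumes "\<delta> ` Univ S \<subseteq> Univ S"
  shows "openin (Ttop S \<delta> n) U \<longleftrightarrow> U \<subseteq> pw S (length n) \<and>
    (\<forall>x\<in>U. \<exists>\<epsilon>\<in>Univ S. lt S \<zero>\<^bsub>fld S\<^esub> \<epsilon> \<and>
      (\<forall>y\<in>pw S (length n). lt S (jdist S \<delta> n x y) \<epsilon> \<longrightarrow> y \<in> U))"
  and topspace_Ttop: "topspace (Ttop S \<delta> n) = pw S (length n)"
  unfolding Ttop_def
  by (rule openin_mtop topspace_mtop; rule jdist_closed[OF assms]; assumption)+

text \<open>Raising orders only adds conditions on derivatives, so a ball for n lies in the ball for
  m with the same centre and radius. The same radius therefore witnesses openness.\<close>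

lemma openin_Ttop_mono:
  assumes \<delta>: "\<delta> ` Univ S \<subseteq> Univ S" and len: "length m = length n"
    and le: "\<And>i. i < length n \<Longrightarrow> m ! i \<le> n ! i" and U: "openin (Ttop S \<delta> m) U"
  shows "openin (Ttop S \<delta> n) U"
proof -
  have less: "lt S (jdist S \<delta> m x y) e"
    if "x \<in> pw S (length n)" "y \<in> pw S (length n)" "e \<in> Univ S" "lt S (jdist S \<delta> n x y) e" for x y e
    using that le jdist_less_iff[OF \<delta>, of x m y e] jdist_less_iff[OF \<delta>, of x n y e] len
    by (metis le_trans)
  show ?thesis
    unfolding openin_Ttop[OF \<delta>]
  proof (intro conjI ballI)
    show UX: "U \<subseteq> pw S (length n)" using U len by (simp add: openin_Ttop[OF \<delta>])
    fix x assume x: "x \<in> U"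
    then obtain e where e: "e \<in> Univ S" "lt S \<zero>\<^bsub>fld S\<^esub> e"
      "\<forall>y\<in>pw S (length n). lt S (jdist S \<delta> m x y) e \<longrightarrow> y \<in> U"
      using U len unfolding openin_Ttop[OF \<delta>] by metis
    then show "\<exists>\<epsilon>\<in>Univ S. lt S \<zero>\<^bsub>fld S\<^esub> \<epsilon> \<and>
        (\<forall>y\<in>pw S (length n). lt S (jdist S \<delta> n x y) \<epsilon> \<longrightarrow> y \<in> U)"
      using less x UX by blast
  qed
qed

lemma openin_Ttop_shift:
  assumes "\<delta> ` Univ S \<subseteq> Univ S" "length m = length n" "openin (Ttop S \<delta> m) U"
  shows "\<exists>r. openin (Ttop S \<delta> (map (\<lambda>l. l + r) n)) U"
proof -
  \<comment> \<open>The sum of \<open>m\<close> bounds all its entries at once, and it is also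
    meaningful for the empty multi-index.\<close>
  have "m ! i \<le> n ! i + sum_list m" if "i < length n" for i
    using that assms(2) by (simp add: elem_le_sum_list trans_le_add2)
  then show ?thesis
    using assms by (intro exI[of _ "sum_list m"] openin_Ttop_mono[OF assms(1) _ _ assms(3)]) auto
qed

text \<open>Induction on how the open set is generated. The claim is local, with \<open>r\<close>
  depending on x, because a union of sets open for different shifts need not be open for a single
  one.\<close>

lemma openin_delta_top_base:
  assumes \<delta>: "\<delta> ` Univ S \<subseteq> Univ S" and n: "length n = k"
    and "openin (delta_top S \<delta> k) U" "x \<in> U"
  shows "\<exists>r V. openin (Ttop S \<delta> (map (\<lambda>l. l + r) n)) V \<and> x \<in> V \<and> V \<subseteq> U"
proof -
  have "generate_topology_on (\<Union>n\<in>{n. length n = k}. {U. openin (Ttop S \<delta> n) U}) U"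
    using assms(3) unfolding delta_top_def openin_topology_generated_by_iff .
  then show ?thesis using \<open>x \<in> U\<close>
  proof (induction arbitrary: x)
    case (Int A B)
    then have x: "x \<in> A" "x \<in> B" by auto
    obtain r V where V: "openin (Ttop S \<delta> (map (\<lambda>l. l + r) n)) V" "x \<in> V" "V \<subseteq> A"
      using Int.IH(1)[OF x(1)] by blast
    obtain s W where W: "openin (Ttop S \<delta> (map (\<lambda>l. l + s) n)) W" "x \<in> W" "W \<subseteq> B"
      using Int.IH(2)[OF x(2)] by blast
    \<comment> \<open>The larger shift refines both topologies, so \<open>V\<close> and
      \<open>W\<close> become open in a common one and can be intersected there.\<close>
    let ?p = "map (\<lambda>l. l + max r s) n"
    have "openin (Ttop S \<delta> ?p) V" "openin (Ttop S \<delta> ?p) W"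
      by (rule openin_Ttop_mono[OF \<delta> _ _ V(1)] openin_Ttop_mono[OF \<delta> _ _ W(1)]; simp)+
    then show ?case using V(2,3) W(2,3) by (intro exI[of _ "max r s"] exI[of _ "V \<inter> W"]) auto
  next
    case (UN K)
    then obtain A where A: "A \<in> K" "x \<in> A" by blast
    obtain r V where "openin (Ttop S \<delta> (map (\<lambda>l. l + r) n)) V" "x \<in> V" "V \<subseteq> A"
      using UN.IH[OF A] by blast
    then show ?case using A(1) by (intro exI[of _ r] exI[of _ V]) auto
  next
    case (Basis U)
    then obtain m where "length m = length n" "openin (Ttop S \<delta> m) U" using n by auto
    \<comment> \<open>A generator is open for some multi-index, hence for a large shift of
      \<open>n\<close>, and serves as its own \<open>V\<close>.\<close>
    from openin_Ttop_shift[OF \<delta> this] Basis.prems show ?case by blast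
  qed simp
qed

text \<open>Closure points for a topology remain closure points for every coarser one. Conversely, a
  neighbourhood contains a basic one that is open for a single shift, and closure for that shift
  already yields a point of \<open>C\<close>.\<close>

lemma delta_top_closure_iff:
  assumes \<delta>: "\<delta> ` Univ S \<subseteq> Univ S" and n: "length n = k"
  shows "a \<in> delta_top S \<delta> k closure_of C \<longleftrightarrow>
    (\<forall>r. a \<in> Ttop S \<delta> (map (\<lambda>l. l + r) n) closure_of C)"
proof -
  have finer: "openin (delta_top S \<delta> k) U" if "openin (Ttop S \<delta> (map (\<lambda>l. l + r) n)) U" for r U
    unfolding delta_top_def by (rule topology_generated_by_Basis) (use that n in \<open>auto intro!: exI[of _ "map (\<lambda>l. l + r) n"]\<close>)
  have "topspace (delta_top S \<delta> k) = pw S k"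
  proof
    show "topspace (delta_top S \<delta> k) \<subseteq> pw S k"
      unfolding delta_top_def topology_generated_by_topspace
      using topspace_Ttop[OF \<delta>] openin_subset by fastforce
    \<comment> \<open>The full power is open for a shift of \<open>n\<close>, hence in the
      \<delta>-topology.\<close>
    show "pw S k \<subseteq> topspace (delta_top S \<delta> k)"
      using openin_subset[OF finer[OF openin_topspace]] n by (simp add: topspace_Ttop[OF \<delta>])
  qed
  then have top: "topspace (delta_top S \<delta> k) = topspace (Ttop S \<delta> (map (\<lambda>l. l + r) n))" for r
    using n by (simp add: topspace_Ttop[OF \<delta>])
  show ?thesis
  proof (intro iffI allI)
    fix r assume "a \<in> delta_top S \<delta> k closure_of C"
    then show "a \<in> Ttop S \<delta> (map (\<lambda>l. l + r) n) closure_of C"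
      unfolding in_closure_of top[of r, symmetric] using finer by blast
  next
    assume cl: "\<forall>r. a \<in> Ttop S \<delta> (map (\<lambda>l. l + r) n) closure_of C"
    have "\<exists>y. y \<in> C \<and> y \<in> U" if U: "a \<in> U" "openin (delta_top S \<delta> k) U" for U
    proof -
      obtain r V where V: "openin (Ttop S \<delta> (map (\<lambda>l. l + r) n)) V" "a \<in> V" "V \<subseteq> U"
        using openin_delta_top_base[OF \<delta> n U(2,1)] by blast
      have "\<exists>y. y \<in> C \<and> y \<in> V" using cl[rule_format, of r] V(1,2) unfolding in_closure_of by blast
      then show ?thesis using V(3) by blast
    qed
    moreover have "a \<in> topspace (delta_top S \<delta> k)"
      \<comment> \<open>All shifts share one underlying space, so membership in it can be read off
        at shift 0.\<close>
      using cl[rule_format, of 0] unfolding top[of 0] in_closure_of by blast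
    ultimately show "a \<in> delta_top S \<delta> k closure_of C" unfolding in_closure_of by blast
  qed
qed

end

section \<open>Closures of \<delta>-cells\<close>

theorem lemma5p1:
  fixes L :: "('f, 'r) language"
    and T :: "('f, 'r, nat) fm set"
    and M :: "('f, 'r, ('f, 'r, 'a) univ) struct"
    and \<delta> :: "('f, 'r, 'a) univ \<Rightarrow> ('f, 'r, 'a) univ"
    and k :: nat
    and C :: "('f, 'r, 'a) univ list set"
    and n :: "nat list"
    and a :: "('f, 'r, 'a) univ list"
  assumes "is_theory L T"
    and "complete_theory TYPE(('f, 'r, 'a) univ) L T"
    and "expands_RCF TYPE(('f, 'r, 'a) univ) L T"
    and "o_minimal_theory TYPE(('f, 'r, 'a) univ) L T"
    and "has_QE TYPE(('f, 'r, 'a) univ) L T"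
    and "universally_axiomatizable TYPE(('f, 'r, 'a) univ) L T"
    and "admits_Cinf_cell_decomposition TYPE(('f, 'r, 'a) univ) L T"
    and "model_Tg_delta L T M \<delta>"
    and "delta_cell L M \<delta> k C"
    and "length n = k"
    and "delta_cell_order L M \<delta> k C n"
    and "a \<in> pw M k"
  shows "(\<forall>r. a \<in> Ttop M \<delta> (map (\<lambda>m. m + r) n) closure_of C \<longleftrightarrow>
            Jet \<delta> (map (\<lambda>m. m + r) n) a
              \<in> E M (map (\<lambda>m. m + r) n) closure_of (Jet \<delta> (map (\<lambda>m. m + r) n) ` C))
       \<and> (a \<in> delta_top M \<delta> k closure_of C \<longleftrightarrow>
            (\<forall>r. a \<in> Ttop M \<delta> (map (\<lambda>m. m + r) n) closure_of C))
       \<and> (a \<in> delta_top M \<delta> k closure_of C \<longleftrightarrow>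
            (\<forall>r. Jet \<delta> (map (\<lambda>m. m + r) n) a
              \<in> E M (map (\<lambda>m. m + r) n) closure_of (Jet \<delta> (map (\<lambda>m. m + r) n) ` C)))"
proof -
  have M: "M \<in> models L T" and \<delta>: "\<delta> ` Univ M \<subseteq> Univ M"
    using assms(8) unfolding model_Tg_delta_def T_derivation_def by auto
  have S: "is_ordered_field M"
    using assms(3) M unfolding expands_RCF_def is_real_closed_field_def by blast
  \<comment> \<open>A source formula for \<open>C\<close> defines it as a subset of the k-th
    power.\<close>
  have C: "C \<subseteq> pw M k"
    using assms(9) unfolding delta_cell_def source_formula_def dset_def by blast
  have jet: "a \<in> Ttop M \<delta> (map (\<lambda>m. m + r) n) closure_of C \<longleftrightarrow>
      Jet \<delta> (map (\<lambda>m. m + r) n) a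
        \<in> E M (map (\<lambda>m. m + r) n) closure_of (Jet \<delta> (map (\<lambda>m. m + r) n) ` C)" for r
    using assms(10,12) C by (intro Ttop_closure_iff_Jet[OF S \<delta>]) simp_all
  \<comment> \<open>Membership in the \<delta>-closure becomes membership in the closure for every
    shift, and \<open>jet\<close> translates each of these into a statement about jets.\<close>
  then show ?thesis unfolding delta_top_closure_iff[OF S \<delta> assms(10)] by blast
qed

end
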